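(* Let $\mathbf{L}=\langle L,\leq,\otimes,\rightarrow,0,1\rangle$ be a complete residuated lattice, let $Y\neq\emptyset$, and let ${}^*$ be an idempotent truth-stressing hedge on $\mathbf{L}$. An operator $C\colon L^Y\to L^Y$ is an $\mathbf{L}^*$-closure operator if and only if it is an $\mathbf{L}_{\{1\}}$-closure operator and $$C(a^*\rightarrow C(A))\subseteq a^*\rightarrow C(A)$$ holds for all $a\in L$ and all $A\in L^Y$.
   Context: A complete (commutative integral) residuated lattice $\mathbf{L}=\langle L,\leq,\otimes,\rightarrow,0,1\rangle$: $\langle L,\leq\rangle$ is a complete lattice with least element $0$ and greatest element $1$, $\otimes$ is associative, commutative with neutral element $1$, and $a\otimes b\leq c$ iff $b\leq a\rightarrow c$ for all $a,b,c\in L$. $L^Y$ is the set of all maps $A\colon Y\to L$ ($\mathbf{L}$-sets in $Y$); $A\subseteq B$ means $A(y)\leq B(y)$ for all $y\in Y$. For $a\in L$ and $A\in L^Y$, $a\rightarrow A$ is the $\mathbf{L}$-set $(a\rightarrow A)(y)=a\rightarrow A(y)$. The subsethood degree is $S(A,B)=\bigwedge_{y\in Y}(A(y)\rightarrow B(y))$. An idempotent truth-stressing hedge is a map ${}^*\colon L\to L$ with $1^*=1$, $a^*\leq a$, $(a\rightarrow b)^*\leq a^*\rightarrow b^*$ and $a^{**}=a^*$ for all $a,b\in L$. An $\mathbf{L}^*$-closure operator is $C\colon L^Y\to L^Y$ with $A\subseteq C(A)$, $S(A,B)^*\leq S(C(A),C(B))$, and $C(C(A))\subseteq C(A)$ for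 all $A,B\in L^Y$. An $\mathbf{L}_{\{1\}}$-closure operator is an ordinary closure operator on $\langle L^Y,\subseteq\rangle$: $A\subseteq C(A)$, $A\subseteq B$ implies $C(A)\subseteq C(B)$, and $C(C(A))\subseteq C(A)$. *)

theory Defs
  imports Main
begin

text \<open>
  The universe of the structure of truth degrees is a type \<open>'a\<close> of class
  \<open>complete_lattice\<close>, with \<open>0 = \<bottom>\<close> and \<open>1 = \<top>\<close>. The universe set \<open>Y\<close> is a type \<open>'y\<close>
  (nonempty, as every HOL type is), an \<open>L\<close>-set in \<open>Y\<close> is a function \<open>'y \<Rightarrow> 'a\<close>, and
  inclusion \<open>A \<subseteq> B\<close> of \<open>L\<close>-sets is the pointwise order \<open>A \<le> B\<close> on functions.
\<close>

locale complete_residuated_lattice =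
  fixes tensor :: "'a::complete_lattice \<Rightarrow> 'a \<Rightarrow> 'a"
    and resid :: "'a \<Rightarrow> 'a \<Rightarrow> 'a"
  assumes tensor_assoc: "tensor (tensor a b) c = tensor a (tensor b c)"
    and tensor_commute: "tensor a b = tensor b a"
    and tensor_top: "tensor a top = a"
    and adjointness: "tensor a b \<le> c \<longleftrightarrow> b \<le> resid a c"

definition shift :: "('a \<Rightarrow> 'a \<Rightarrow> 'a) \<Rightarrow> 'a \<Rightarrow> ('y \<Rightarrow> 'a) \<Rightarrow> 'y \<Rightarrow> 'a" where
  "shift resid a A = (\<lambda>y. resid a (A y))"

definition subsethood :: "('a::complete_lattice \<Rightarrow> 'a \<Rightarrow> 'a) \<Rightarrow> ('y \<Rightarrow> 'a) \<Rightarrow> ('y \<Rightarrow> 'a) \<Rightarrow> 'a" where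
  "subsethood resid A B = (INF y. resid (A y) (B y))"

definition idempotent_hedge ::
    "('a::complete_lattice \<Rightarrow> 'a \<Rightarrow> 'a) \<Rightarrow> ('a \<Rightarrow> 'a) \<Rightarrow> bool" where
  "idempotent_hedge resid h \<longleftrightarrow>
     h top = top \<and>
     (\<forall>a. h a \<le> a) \<and>
     (\<forall>a b. h (resid a b) \<le> resid (h a) (h b)) \<and>
     (\<forall>a. h (h a) = h a)"

definition hedge_closure_operator ::
    "('a::complete_lattice \<Rightarrow> 'a \<Rightarrow> 'a) \<Rightarrow> ('a \<Rightarrow> 'a) \<Rightarrow> (('y \<Rightarrow> 'a) \<Rightarrow> 'y \<Rightarrow> 'a) \<Rightarrow> bool" where
  "hedge_closure_operator resid h C \<longleftrightarrow>
     (\<forall>A. A \<le> C A) \<and>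
     (\<forall>A B. h (subsethood resid A B) \<le> subsethood resid (C A) (C B)) \<and>
     (\<forall>A. C (C A) \<le> C A)"

definition closure_operator :: "(('y \<Rightarrow> 'a::complete_lattice) \<Rightarrow> 'y \<Rightarrow> 'a) \<Rightarrow> bool" where
  "closure_operator C \<longleftrightarrow>
     (\<forall>A. A \<le> C A) \<and>
     (\<forall>A B. A \<le> B \<longrightarrow> C A \<le> C B) \<and>
     (\<forall>A. C (C A) \<le> C A)"

end

theory Submission
  imports Defs
begin

text \<open>
  By adjointness, \<open>c \<le> S(A, B)\<close> iff \<open>A \<subseteq> c \<rightarrow> B\<close>. So the monotony condition of a hedge closure
  operator says that \<open>A \<subseteq> c \<rightarrow> B\<close> implies \<open>C(A) \<subseteq> c \<rightarrow> C(B)\<close> for all fixed points \<open>c\<close> of the hedge,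
  and for an ordinary closure operator this amounts to closedness of \<open>c \<rightarrow> C(B)\<close>.
\<close>

context complete_residuated_lattice
begin

text \<open>Both sides say \<open>tensor c (A y) \<le> B y\<close> for all \<open>y\<close>:
  commutativity lets \<open>c\<close> and \<open>A y\<close> swap roles in adjointness.\<close>

lemma le_subsethood_iff: "c \<le> subsethood resid A B \<longleftrightarrow> A \<le> shift resid c B"
proof -
  have "c \<le> resid x y \<longleftrightarrow> x \<le> resid c y" for x y
    using adjointness[of x c y] adjointness[of c x y] by (simp add: tensor_commute)
  then show ?thesis
    by (simp add: subsethood_def shift_def le_fun_def le_INF_iff)
qed

lemma resid_eq_top_iff: "resid a b = top \<longleftrightarrow> a \<le> b"
  using adjointness[of a top b] by (simp add: tensor_top top_unique)

lemma resid_top: "resid top b = b"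
proof (rule order.antisym)
  show "resid top b \<le> b"
    using adjointness[of top "resid top b" b] by (simp add: tensor_commute[of top] tensor_top)
  show "b \<le> resid top b"
    using adjointness[of top b b] by (simp add: tensor_commute[of top] tensor_top)
qed

lemma shift_top: "shift resid top A = A"
  by (simp add: shift_def resid_top)

lemma shift_mono:
  assumes "A \<le> B"
  shows "shift resid a A \<le> shift resid a B"
proof (rule le_funI)
  fix y
  have "tensor a (resid a (A y)) \<le> A y"
    by (simp add: adjointness)
  also have "\<dots> \<le> B y"
    using assms by (rule le_funD)
  finally show "shift resid a A y \<le> shift resid a B y"
    by (simp add: shift_def adjointness)
qed

text \<open>If \<open>a \<le> b\<close>, then \<open>resid a b\<close> is \<open>top\<close>, which
  \<open>h\<close> fixes, so \<open>resid (h a) (h b)\<close> is \<open>top\<close> as well.\<close>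

lemma idempotent_hedge_mono:
  assumes "idempotent_hedge resid h" and "a \<le> b"
  shows "h a \<le> h b"
proof -
  have "h (resid a b) \<le> resid (h a) (h b)" and "h top = top"
    using assms(1) by (auto simp: idempotent_hedge_def)
  moreover have "resid a b = top"
    using assms(2) by (simp add: resid_eq_top_iff)
  ultimately show ?thesis
    by (simp add: top_unique resid_eq_top_iff)
qed

text \<open>Idempotency makes \<open>h a\<close> a fixed point, so applying \<open>h\<close> to
  \<open>h a \<le> subsethood resid A B\<close> leaves the left side unchanged.\<close>

lemma hedge_closure_operator_le_shift:
  assumes hedge: "idempotent_hedge resid h"
    and C: "hedge_closure_operator resid h C"
    and le: "A \<le> shift resid (h a) B"
  shows "C A \<le> shift resid (h a) (C B)"
proof -
  have "h a = h (h a)"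
    using hedge by (simp add: idempotent_hedge_def)
  also have "\<dots> \<le> h (subsethood resid A B)"
    using le by (intro idempotent_hedge_mono[OF hedge]) (simp add: le_subsethood_iff)
  also have "\<dots> \<le> subsethood resid (C A) (C B)"
    using C by (simp add: hedge_closure_operator_def)
  finally show ?thesis
    by (simp add: le_subsethood_iff)
qed

text \<open>Ordinary monotony is the case of degree \<open>top\<close>, which \<open>h\<close> fixes
  and by which shifting changes nothing.\<close>

lemma hedge_closure_operator_imp_closure_operator:
  assumes hedge: "idempotent_hedge resid h" and C: "hedge_closure_operator resid h C"
  shows "closure_operator C"
proof -
  have "h top = top"
    using hedge by (simp add: idempotent_hedge_def)
  then have "C A \<le> C B" if "A \<le> B" for A B
    using hedge_closure_operator_le_shift[OF hedge C, of A top B] that by (simp add: shift_top)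
  then show ?thesis
    using C by (simp add: closure_operator_def hedge_closure_operator_def)
qed

lemma hedge_closure_operator_shift_closed:
  assumes hedge: "idempotent_hedge resid h" and C: "hedge_closure_operator resid h C"
  shows "C (shift resid (h a) (C A)) \<le> shift resid (h a) (C A)"
proof -
  \<comment> \<open>The reflexive inclusion of the shifted set in itself is the premise here, with
    \<open>C A\<close> in the role of \<open>B\<close>.\<close>
  have "C (shift resid (h a) (C A)) \<le> shift resid (h a) (C (C A))"
    using hedge C order.refl by (rule hedge_closure_operator_le_shift)
  also have "\<dots> \<le> shift resid (h a) (C A)"
    using C by (intro shift_mono) (simp add: hedge_closure_operator_def)
  finally show ?thesis .
qed

text \<open>Shifting \<open>C B\<close> by the hedged subsethood degree gives a closed set above
  \<open>A\<close>, hence above \<open>C A\<close>.\<close>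

lemma closure_operator_imp_hedge_closure_operator:
  assumes hedge: "idempotent_hedge resid h" and C: "closure_operator C"
    and closed: "\<And>a A. C (shift resid (h a) (C A)) \<le> shift resid (h a) (C A)"
  shows "hedge_closure_operator resid h C"
proof -
  have "h (subsethood resid A B) \<le> subsethood resid (C A) (C B)" for A B
  proof -
    let ?s = "h (subsethood resid A B)"
    have "?s \<le> subsethood resid A B"
      using hedge by (simp add: idempotent_hedge_def)
    then have "A \<le> shift resid ?s B"
      by (simp add: le_subsethood_iff)
    also have "\<dots> \<le> shift resid ?s (C B)"
      using C by (intro shift_mono) (simp add: closure_operator_def)
    finally have "C A \<le> C (shift resid ?s (C B))"
      using C by (simp add: closure_operator_def)
    \<comment> \<open>\<open>closed\<close> applies since \<open>?s\<close> is a value of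
      \<open>h\<close>, taken at \<open>subsethood resid A B\<close>.\<close>
    also have "\<dots> \<le> shift resid ?s (C B)"
      by (rule closed)
    finally show ?thesis
      by (simp add: le_subsethood_iff)
  qed
  then show ?thesis
    using C by (simp add: closure_operator_def hedge_closure_operator_def)
qed

end

theorem theorem6:
  fixes tensor resid :: "'a::complete_lattice \<Rightarrow> 'a \<Rightarrow> 'a"
    and h :: "'a \<Rightarrow> 'a"
    and C :: "('y \<Rightarrow> 'a) \<Rightarrow> 'y \<Rightarrow> 'a"
  assumes "complete_residuated_lattice tensor resid"
    and "idempotent_hedge resid h"
  shows "hedge_closure_operator resid h C \<longleftrightarrow>
    closure_operator C \<and>
    (\<forall>a A. C (shift resid (h a) (C A)) \<le> shift resid (h a) (C A))"
proof -
  interpret complete_residuated_lattice tensor resid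
    by (fact assms(1))
  show ?thesis
    using hedge_closure_operator_imp_closure_operator[OF assms(2)]
      hedge_closure_operator_shift_closed[OF assms(2)]
      closure_operator_imp_hedge_closure_operator[OF assms(2)]
    by blast
qed

end
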